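(* Let $A$ be a $k$-element set $(k\geq 3)$ and let $c\in A$. If $\sigma_c$ is the $(k-1)$-ary central relation on $A$ with central element $c$, then $\mathrm{Pol}(\sigma_c,\{c\})\in\mathfrak{F}_A$.
   Context: For $n\ge 1$, an $n$-ary operation on $A$ is a function $A^n\to A$; $\mathcal{O}_A$ is the set of all finitary operations on $A$, and $\mathcal{C}^{(n)}$ is the set of $n$-ary members of $\mathcal{C}\subseteq\mathcal{O}_A$. A clone on $A$ is a set $\mathcal{C}\subseteq\mathcal{O}_A$ containing all projections and closed under composition. For a clone $\mathcal{C}$, an $n$-ary $f$ and an $m$-ary $g$ in $\mathcal{O}_A$, write $f\leq_{\mathcal{C}} g$ if $f=g(h_1,\dots,h_m)$ for some $h_1,\dots,h_m\in\mathcal{C}^{(n)}$, and $f\equiv_{\mathcal{C}}g$ if $f\leq_{\mathcal{C}}g$ and $g\leq_{\mathcal{C}}f$. $\mathfrak{F}_A$ denotes the set of all clones $\mathcal{C}$ on $A$ such that the equivalence relation $\equiv_{\mathcal{C}}$ on $\mathcal{O}_A$ has only finitely many classes. $\sigma_c=\{(a_1,\dots,a_{k-1})\in A^{k-1}: a_i=a_j\text{ for some } 1\le i<j\le k-1,\text{ or } a_i=c\text{ for some }1\le i\le k-1\}$. $\mathrm{Pol}(\sigma_c,\{c\})$ is the clone of all operations on $A$ preserving both the relation $\sigma_c$ and the unary relation $\{c\}$, where an operation preserves a relation if applying it coordinatewise to tuples of the relation gives a tuple of the relation. *)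

theory Defs
  imports Main "HOL-Library.FuncSet"
begin

definition tuples :: "'a set \<Rightarrow> nat \<Rightarrow> 'a list set" where
  "tuples A n = {xs. length xs = n \<and> set xs \<subseteq> A}"

text \<open>
  An operation is recorded together with its arity. The function part is required to be
  extensional, so that equality of operations of the same arity is equality as functions
  from \<open>tuples A n\<close> to \<open>A\<close>.
\<close>
type_synonym 'a operation = "nat \<times> ('a list \<Rightarrow> 'a)"

definition ops :: "'a set \<Rightarrow> 'a operation set" where
  "ops A = {(n, f). n \<ge> 1 \<and> f \<in> tuples A n \<rightarrow>\<^sub>E A}"

definition nary :: "'a operation set \<Rightarrow> nat \<Rightarrow> 'a operation set" where
  "nary C n = {f \<in> C. fst f = n}"

definition proj :: "'a set \<Rightarrow> nat \<Rightarrow> nat \<Rightarrow> 'a operation" where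
  "proj A n i = (n, \<lambda>xs\<in>tuples A n. xs ! i)"

text \<open>
  The \<open>n\<close>-ary operation \<open>g(h\<^sub>1, \<dots>, h\<^sub>m)\<close>, for \<open>m\<close>-ary \<open>g\<close> and a list \<open>hs\<close> of \<open>m\<close> operations
  of arity \<open>n\<close>.
\<close>
definition op_comp :: "'a set \<Rightarrow> nat \<Rightarrow> 'a operation \<Rightarrow> 'a operation list \<Rightarrow> 'a operation" where
  "op_comp A n g hs = (n, \<lambda>xs\<in>tuples A n. snd g (map (\<lambda>h. snd h xs) hs))"

definition is_clone :: "'a set \<Rightarrow> 'a operation set \<Rightarrow> bool" where
  "is_clone A C \<longleftrightarrow>
     C \<subseteq> ops A \<and>
     (\<forall>n i. n \<ge> 1 \<and> i < n \<longrightarrow> proj A n i \<in> C) \<and>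
     (\<forall>g\<in>C. \<forall>n\<ge>1. \<forall>hs. length hs = fst g \<and> set hs \<subseteq> nary C n \<longrightarrow> op_comp A n g hs \<in> C)"

definition op_le :: "'a set \<Rightarrow> 'a operation set \<Rightarrow> 'a operation \<Rightarrow> 'a operation \<Rightarrow> bool" where
  "op_le A C f g \<longleftrightarrow>
     (\<exists>hs. length hs = fst g \<and> set hs \<subseteq> nary C (fst f) \<and> f = op_comp A (fst f) g hs)"

definition op_equiv :: "'a set \<Rightarrow> 'a operation set \<Rightarrow> ('a operation \<times> 'a operation) set" where
  "op_equiv A C = {(f, g). f \<in> ops A \<and> g \<in> ops A \<and> op_le A C f g \<and> op_le A C g f}"

definition finite_clones :: "'a set \<Rightarrow> 'a operation set set" where
  "finite_clones A = {C. is_clone A C \<and> finite (ops A // op_equiv A C)}"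

text \<open>
  Here \<open>\<rho>\<close> is an \<open>r\<close>-ary relation, \<open>as\<close> is a list of \<open>n\<close> tuples of \<open>\<rho>\<close> (the columns), and \<open>f\<close> is
  applied to each of the \<open>r\<close> rows.
\<close>
definition preserves :: "'a operation \<Rightarrow> nat \<Rightarrow> 'a list set \<Rightarrow> bool" where
  "preserves f r \<rho> \<longleftrightarrow>
     (\<forall>as. length as = fst f \<and> set as \<subseteq> \<rho> \<longrightarrow>
        map (\<lambda>i. snd f (map (\<lambda>a. a ! i) as)) [0..<r] \<in> \<rho>)"

text \<open>Relations are given as pairs of their arity and their set of tuples.\<close>
definition Pol :: "'a set \<Rightarrow> (nat \<times> 'a list set) set \<Rightarrow> 'a operation set" where
  "Pol A R = {f \<in> ops A. \<forall>(r, \<rho>)\<in>R. preserves f r \<rho>}"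

text \<open>The \<open>r\<close>-ary central relation with central element \<open>c\<close>, with tuples indexed from \<open>0\<close>.\<close>
definition central_rel :: "'a set \<Rightarrow> nat \<Rightarrow> 'a \<Rightarrow> 'a list set" where
  "central_rel A r c =
     {a \<in> tuples A r. (\<exists>i j. i < j \<and> j < r \<and> a ! i = a ! j) \<or> (\<exists>i<r. a ! i = c)}"

end

theory Submission imports Defs begin

text \<open>
  Write \<open>\<sigma>\<^sub>c\<close> for the central relation and \<open>c\<^sub>n\<close> for the constant tuple \<open>(c, \<dots>, c)\<close>. A \<open>(k-1)\<close>-tuple
  over \<open>A\<close> lies outside \<open>\<sigma>\<^sub>c\<close> iff its entries are exactly the elements of \<open>A - {c}\<close>. To an \<open>n\<close>-ary
  operation \<open>f\<close> attach the element \<open>d = f(c\<^sub>n)\<close>, the range of \<open>f\<close>, and the truth value of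
  ``\<open>f\<close> maps some \<open>n\<close> columns from \<open>\<sigma>\<^sub>c\<close> to a tuple outside \<open>\<sigma>\<^sub>d\<close>''. If these data agree for \<open>f\<close> and \<open>g\<close>,
  then \<open>f = g \<circ> t \<circ> f\<close> for every section \<open>t\<close> of \<open>g\<close> over its range, and the coordinates of
  \<open>t \<circ> f\<close> lie in the clone provided \<open>t d\<close> is the constant tuple and, when the truth value is true,
  \<open>t\<close> takes its other values among the rows of a witness for \<open>g\<close>. There are
  only finitely many such data.
\<close>

section \<open>Operations preserving a set of relations form a clone\<close>

lemma map_nth_in_tuples:
  assumes "set as \<subseteq> \<rho>" "\<rho> \<subseteq> tuples A r" "i < r"
  shows "map (\<lambda>a. a ! i) as \<in> tuples A (length as)"
  using assms by (fastforce simp: tuples_def)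

lemma snd_in_tuples:
  assumes "f \<in> ops A" "xs \<in> tuples A (fst f)"
  shows "snd f xs \<in> A"
  using assms by (auto simp: ops_def)

lemma op_comp_in_ops:
  assumes "g \<in> ops A" "n \<ge> 1" "length hs = fst g" "set hs \<subseteq> nary (ops A) n"
  shows "op_comp A n g hs \<in> ops A"
proof -
  have "map (\<lambda>h. snd h xs) hs \<in> tuples A (fst g)" if "xs \<in> tuples A n" for xs
    using that assms(3,4) snd_in_tuples by (fastforce simp: tuples_def nary_def)
  then show ?thesis
    using assms(1,2) snd_in_tuples by (auto simp: op_comp_def ops_def)
qed

lemma preserves_proj:
  assumes "i < n" "\<rho> \<subseteq> tuples A r"
  shows "preserves (proj A n i) r \<rho>"
  unfolding preserves_def
proof (intro allI impI)
  fix as assume as: "length as = fst (proj A n i) \<and> set as \<subseteq> \<rho>"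
  then have len: "length as = n" by (simp add: proj_def)
  then have mem: "as ! i \<in> \<rho>" using as assms(1) by auto
  then have "length (as ! i) = r" using assms(2) by (auto simp: tuples_def)
  moreover have "map (\<lambda>a. a ! j) as \<in> tuples A n" if "j < r" for j
    using map_nth_in_tuples that as len assms(2) by metis
  ultimately have "map (\<lambda>j. snd (proj A n i) (map (\<lambda>a. a ! j) as)) [0..<r] = as ! i"
    using len assms(1) by (intro nth_equalityI) (auto simp: proj_def)
  then show "map (\<lambda>j. snd (proj A n i) (map (\<lambda>a. a ! j) as)) [0..<r] \<in> \<rho>"
    using mem by simp
qed

lemma preserves_op_comp:
  assumes "\<rho> \<subseteq> tuples A r" "preserves g r \<rho>" "length hs = fst g"
    and hs: "\<And>h. h \<in> set hs \<Longrightarrow> fst h = n \<and> preserves h r \<rho>"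
  shows "preserves (op_comp A n g hs) r \<rho>"
  unfolding preserves_def
proof (intro allI impI)
  fix as assume as: "length as = fst (op_comp A n g hs) \<and> set as \<subseteq> \<rho>"
  then have len: "length as = n" by (simp add: op_comp_def)
  \<comment> \<open>Each inner operation turns the columns \<open>as\<close> into one tuple of
    \<open>\<rho>\<close>; these tuples serve as the columns for \<open>g\<close>.\<close>
  define bs where "bs = map (\<lambda>h. map (\<lambda>i. snd h (map (\<lambda>a. a ! i) as)) [0..<r]) hs"
  have "set bs \<subseteq> \<rho>"
    using hs as len by (auto simp: bs_def preserves_def)
  moreover have "length bs = fst g" using assms(3) by (simp add: bs_def)
  ultimately have "map (\<lambda>i. snd g (map (\<lambda>a. a ! i) bs)) [0..<r] \<in> \<rho>"
    using assms(2) by (auto simp: preserves_def)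
  have "snd (op_comp A n g hs) (map (\<lambda>a. a ! i) as) = snd g (map (\<lambda>a. a ! i) bs)"
    if "i < r" for i
  proof -
    have "map (\<lambda>a. a ! i) as \<in> tuples A n"
      using map_nth_in_tuples that as len assms(1) by metis
    then show ?thesis using that by (simp add: op_comp_def bs_def comp_def)
  qed
  then have eq: "map (\<lambda>i. snd (op_comp A n g hs) (map (\<lambda>a. a ! i) as)) [0..<r] =
      map (\<lambda>i. snd g (map (\<lambda>a. a ! i) bs)) [0..<r]"
    by simp
  show "map (\<lambda>i. snd (op_comp A n g hs) (map (\<lambda>a. a ! i) as)) [0..<r] \<in> \<rho>"
    unfolding eq by fact
qed

lemma is_clone_Pol:
  assumes "\<And>r \<rho>. (r, \<rho>) \<in> R \<Longrightarrow> \<rho> \<subseteq> tuples A r"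
  shows "is_clone A (Pol A R)"
  unfolding is_clone_def
proof (intro conjI allI impI ballI)
  show "Pol A R \<subseteq> ops A" by (auto simp: Pol_def)
next
  fix n i :: nat assume "n \<ge> 1 \<and> i < n"
  moreover from this have "proj A n i \<in> ops A"
    by (auto simp: proj_def ops_def tuples_def)
  ultimately show "proj A n i \<in> Pol A R"
    using assms by (auto simp: Pol_def intro: preserves_proj)
next
  fix g n hs
  assume g: "g \<in> Pol A R" and n: "(1::nat) \<le> n"
    and hs: "length hs = fst g \<and> set hs \<subseteq> nary (Pol A R) n"
  have "op_comp A n g hs \<in> ops A"
    using g n hs by (intro op_comp_in_ops) (auto simp: Pol_def nary_def)
  moreover have "preserves (op_comp A n g hs) r \<rho>" if "(r, \<rho>) \<in> R" for r \<rho>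
    using g hs that assms[OF that]
    by (intro preserves_op_comp) (auto simp: Pol_def nary_def)
  ultimately show "op_comp A n g hs \<in> Pol A R" by (auto simp: Pol_def)
qed

section \<open>The quasi-order of a clone and a criterion for finitely many classes\<close>

lemma op_le_trans:
  assumes C: "is_clone A C" and f: "f \<in> ops A"
    and fg: "op_le A C f g" and gu: "op_le A C g u"
  shows "op_le A C f u"
proof -
  obtain hs where hs: "length hs = fst g" "set hs \<subseteq> nary C (fst f)" "f = op_comp A (fst f) g hs"
    using fg by (auto simp: op_le_def)
  obtain hs' where hs': "length hs' = fst u" "set hs' \<subseteq> nary C (fst g)"
      "g = op_comp A (fst g) u hs'"
    using gu by (auto simp: op_le_def)
  define ks where "ks = map (\<lambda>h. op_comp A (fst f) h hs) hs'"
  have "fst f \<ge> 1" using f by (auto simp: ops_def)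
  then have "op_comp A (fst f) h hs \<in> C" if "h \<in> set hs'" for h
    using C hs(1,2) hs'(2) that unfolding is_clone_def
    by (metis (mono_tags, lifting) mem_Collect_eq nary_def subsetD)
  then have "set ks \<subseteq> nary C (fst f)"
    by (auto simp: ks_def nary_def op_comp_def)
  moreover have "snd g (map (\<lambda>h. snd h xs) hs) = snd u (map (\<lambda>k. snd k xs) ks)"
    if xs: "xs \<in> tuples A (fst f)" for xs
  proof -
    have "snd h xs \<in> A" if "h \<in> set hs" for h
      using that xs hs(2) C by (intro snd_in_tuples) (auto simp: nary_def is_clone_def)
    then have "map (\<lambda>h. snd h xs) hs \<in> tuples A (fst g)"
      using hs(1) by (auto simp: tuples_def)
    moreover have "snd g ys = snd u (map (\<lambda>h. snd h ys) hs')" if "ys \<in> tuples A (fst g)" for ys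
      using that by (subst hs'(3)) (simp add: op_comp_def)
    ultimately show ?thesis
      using xs by (simp add: ks_def op_comp_def comp_def)
  qed
  then have "f = op_comp A (fst f) u ks"
    by (subst hs(3)) (auto simp: op_comp_def intro!: restrict_ext)
  ultimately show ?thesis
    using hs'(1) unfolding op_le_def by (intro exI[of _ ks]) (simp add: ks_def)
qed

text \<open>Equality of \<open>\<phi>\<close> is symmetric, so \<open>le\<close> gives both
  directions: the class of an operation depends only on its value under \<open>\<phi>\<close>, and
  there are at most as many classes as values.\<close>

lemma finite_clonesI:
  assumes C: "is_clone A C" and fin: "finite (\<phi> ` ops A)"
    and le: "\<And>f g. f \<in> ops A \<Longrightarrow> g \<in> ops A \<Longrightarrow> \<phi> f = \<phi> g \<Longrightarrow> op_le A C f g"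
  shows "C \<in> finite_clones A"
proof -
  let ?R = "op_equiv A C"
  \<comment> \<open>\<open>cl i\<close> is the union of the classes of all operations with value
    \<open>i\<close>. This makes the class a function of \<open>i\<close> without choosing
    representatives; transitivity shows that the union is a single class.\<close>
  define cl where "cl i = {g. \<exists>f\<in>ops A. \<phi> f = i \<and> (f, g) \<in> ?R}" for i
  have "?R `` {f} = cl (\<phi> f)" if f: "f \<in> ops A" for f
  proof (intro equalityI subsetI)
    fix g assume "g \<in> cl (\<phi> f)"
    then obtain f' where f': "f' \<in> ops A" "\<phi> f' = \<phi> f" "(f', g) \<in> ?R"
      by (auto simp: cl_def)
    then have "op_le A C f f'" "op_le A C f' f" using le f by auto
    then show "g \<in> ?R `` {f}"
      using f f' op_le_trans[OF C] unfolding op_equiv_def by blast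
  qed (use f in \<open>auto simp: cl_def\<close>)
  then have "ops A // ?R \<subseteq> cl ` \<phi> ` ops A"
    by (auto simp: quotient_def)
  then have "finite (ops A // ?R)" by (rule finite_subset) (use fin in simp)
  then show ?thesis using C by (simp add: finite_clones_def)
qed

section \<open>The central relation and sections adapted to it\<close>

text \<open>A tuple has as many entries as \<open>A - {c}\<close> has elements, so being injective
  and avoiding \<open>c\<close> is the same as having entry set \<open>A - {c}\<close>. Membership
  thus becomes a question about images of sets.\<close>

lemma mem_central_rel_iff:
  assumes "finite A" "c \<in> A"
  shows "a \<in> central_rel A (card A - 1) c \<longleftrightarrow> a \<in> tuples A (card A - 1) \<and> set a \<noteq> A - {c}"
proof (cases "a \<in> tuples A (card A - 1)")
  case True
  then have len: "length a = card (A - {c})" and sub: "set a \<subseteq> A"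
    using assms by (auto simp: tuples_def)
  have "set a = A - {c} \<longleftrightarrow> distinct a \<and> c \<notin> set a"
  proof
    assume "set a = A - {c}"
    then show "distinct a \<and> c \<notin> set a"
      using len by (metis card_distinct DiffD2 singletonI)
  next
    assume "distinct a \<and> c \<notin> set a"
    then show "set a = A - {c}"
      using len sub assms(1) by (intro card_subset_eq) (auto simp: distinct_card)
  qed
  moreover have "distinct a \<longleftrightarrow> \<not> (\<exists>i j. i < j \<and> j < length a \<and> a ! i = a ! j)"
  proof
    show "distinct a" if "\<not> (\<exists>i j. i < j \<and> j < length a \<and> a ! i = a ! j)"
      using that unfolding distinct_conv_nth by (metis nat_neq_iff)
  qed (auto simp: distinct_conv_nth)
  ultimately show ?thesis
    using True by (auto simp: central_rel_def tuples_def in_set_conv_nth)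
qed (simp add: central_rel_def)

definition leaves_central :: "'a set \<Rightarrow> 'a \<Rightarrow> 'a operation \<Rightarrow> bool" where
  "leaves_central A c f \<longleftrightarrow>
     (\<exists>as. length as = fst f \<and> set as \<subseteq> central_rel A (card A - 1) c \<and>
        (\<lambda>i. snd f (map (\<lambda>a. a ! i) as)) ` {..<card A - 1} = A - {snd f (replicate (fst f) c)})"

lemma replicate_in_tuples: "c \<in> A \<Longrightarrow> replicate n c \<in> tuples A n"
  by (auto simp: tuples_def)

text \<open>The third property is what later keeps each coordinate of \<open>t\<close> after
  \<open>f\<close> inside \<open>Pol\<close>. With a witness for \<open>leaves_central\<close>, the
  values of \<open>t\<close> on \<open>A - {d}\<close> are rows of it, so their \<open>j\<close>-th
  entries all come from one column, a tuple of the central relation.\<close>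

lemma exists_section:
  assumes A: "finite A" "c \<in> A" and g: "g \<in> ops A"
  defines "d \<equiv> snd g (replicate (fst g) c)"
  obtains t where "\<And>v. v \<in> snd g ` tuples A (fst g) \<Longrightarrow> t v \<in> tuples A (fst g) \<and> snd g (t v) = v"
    and "t d = replicate (fst g) c"
    and "\<And>j. leaves_central A c g \<Longrightarrow> j < fst g \<Longrightarrow> (\<lambda>v. t v ! j) ` (A - {d}) \<noteq> A - {c}"
proof (cases "leaves_central A c g")
  case False
  define s where "s v = (SOME x. x \<in> tuples A (fst g) \<and> snd g x = v)" for v
  have s: "s v \<in> tuples A (fst g) \<and> snd g (s v) = v" if "v \<in> snd g ` tuples A (fst g)" for v
    unfolding s_def by (rule someI_ex) (use that in auto)
  show ?thesis
    \<comment> \<open>Redefining a section at \<open>d\<close> is harmless, since \<open>g\<close>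
      sends the constant tuple to \<open>d\<close>; the third property is vacuous here.\<close>
    by (rule that[of "s(d := replicate (fst g) c)"])
      (use s False A replicate_in_tuples[OF A(2)] in \<open>auto simp: d_def\<close>)
next
  case True
  let ?\<sigma> = "central_rel A (card A - 1) c"
  obtain as where as: "length as = fst g" "set as \<subseteq> ?\<sigma>"
    and onto: "(\<lambda>i. snd g (map (\<lambda>a. a ! i) as)) ` {..<card A - 1} = A - {d}"
    using True by (auto simp: leaves_central_def d_def)
  have row: "map (\<lambda>a. a ! i) as \<in> tuples A (fst g)" if "i < card A - 1" for i
    using map_nth_in_tuples[OF as(2) _ that] as(1) by (metis (lifting) central_rel_def mem_Collect_eq subsetI)
  have "\<forall>v\<in>A - {d}. \<exists>i<card A - 1. snd g (map (\<lambda>a. a ! i) as) = v"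
    unfolding onto[symmetric] by auto
  \<comment> \<open>\<open>e v\<close> is the index of a witness row on which \<open>g\<close> takes
    the value \<open>v\<close>.\<close>
  then obtain e where e: "\<And>v. v \<in> A - {d} \<Longrightarrow> e v < card A - 1 \<and> snd g (map (\<lambda>a. a ! e v) as) = v"
    by metis
  define t where "t v = (if v = d then replicate (fst g) c else map (\<lambda>a. a ! e v) as)" for v
  show ?thesis
  proof (rule that[of t])
    fix v assume "v \<in> snd g ` tuples A (fst g)"
    then have "v \<in> A" using snd_in_tuples[OF g] by auto
    then show "t v \<in> tuples A (fst g) \<and> snd g (t v) = v"
    proof (cases "v = d")
      case True
      then show ?thesis using replicate_in_tuples[OF A(2)] by (simp add: t_def d_def)
    next
      case False
      then show ?thesis using e[of v] row[of "e v"] \<open>v \<in> A\<close> by (simp add: t_def)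
    qed
  next
    fix j assume j: "j < fst g"
    then have mem: "as ! j \<in> ?\<sigma>" using as by (metis nth_mem subsetD)
    then have len: "length (as ! j) = card (A - {c})" and ne: "set (as ! j) \<noteq> A - {c}"
      unfolding mem_central_rel_iff[OF A] using A by (simp_all add: tuples_def)
    have sub: "(\<lambda>v. t v ! j) ` (A - {d}) \<subseteq> set (as ! j)"
    proof
      fix w assume "w \<in> (\<lambda>v. t v ! j) ` (A - {d})"
      then obtain v where v: "v \<in> A - {d}" and w: "w = as ! j ! e v"
        using j as(1) by (auto simp: t_def)
      have "e v < length (as ! j)" using e[OF v] len A by simp
      then show "w \<in> set (as ! j)" using w by simp
    qed
    show "(\<lambda>v. t v ! j) ` (A - {d}) \<noteq> A - {c}"
    proof
      assume "(\<lambda>v. t v ! j) ` (A - {d}) = A - {c}"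
      then have "A - {c} \<subseteq> set (as ! j)" using sub by blast
      \<comment> \<open>A column has at most \<open>card (A - {c})\<close> distinct entries, so
        containing \<open>A - {c}\<close> forces equality.\<close>
      then have "A - {c} = set (as ! j)"
        using len card_length[of "as ! j"] by (intro card_seteq) simp_all
      then show False using ne by simp
    qed
  qed (simp add: t_def)
qed

text \<open>One-sided conditions suffice for one direction of the quasi-order: the range inclusion
  makes \<open>t\<close> after \<open>f\<close> meaningful, and the implication transfers a
  violation for \<open>f\<close> to a witness for \<open>g\<close>, where the section excludes
  it.\<close>

lemma op_le_Pol_central:
  fixes A :: "'a set"
  assumes A: "finite A" "c \<in> A" and f: "f \<in> ops A" and g: "g \<in> ops A"
    and eq: "snd f (replicate (fst f) c) = snd g (replicate (fst g) c)"
    and ran: "snd f ` tuples A (fst f) \<subseteq> snd g ` tuples A (fst g)"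
    and leaves: "leaves_central A c f \<Longrightarrow> leaves_central A c g"
  shows "op_le A (Pol A {(card A - 1, central_rel A (card A - 1) c), (1, {[c]})}) f g"
proof -
  let ?n = "fst f" and ?p = "fst g" and ?r = "card A - 1"
  let ?\<sigma> = "central_rel A ?r c"
  define d where "d = snd f (replicate ?n c)"
  obtain t where t: "\<And>v. v \<in> snd g ` tuples A ?p \<Longrightarrow> t v \<in> tuples A ?p \<and> snd g (t v) = v"
    and td: "t d = replicate ?p c"
    and ts: "\<And>j. leaves_central A c g \<Longrightarrow> j < ?p \<Longrightarrow> (\<lambda>v. t v ! j) ` (A - {d}) \<noteq> A - {c}"
    using exists_section[OF A g] eq unfolding d_def by metis
  have tf: "t (snd f xs) \<in> tuples A ?p" "snd g (t (snd f xs)) = snd f xs"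
    if "xs \<in> tuples A ?n" for xs
    using t ran that by blast+
  have n: "?n \<ge> 1" using f by (auto simp: ops_def)
  define h :: "nat \<Rightarrow> 'a operation" where "h j = (?n, \<lambda>xs\<in>tuples A ?n. t (snd f xs) ! j)" for j
  have tfj: "t (snd f xs) ! j \<in> A" if "xs \<in> tuples A ?n" "j < ?p" for xs j
    using tf(1)[OF that(1)] that(2) by (auto simp: tuples_def)
  have "h j \<in> Pol A {(?r, ?\<sigma>), (1, {[c]})}" if j: "j < ?p" for j
  proof -
    have "h j \<in> ops A"
      using n tfj j by (auto simp: h_def ops_def)
    moreover have "preserves (h j) 1 {[c]}"
      unfolding preserves_def
    proof (intro allI impI)
      fix as assume as: "length as = fst (h j) \<and> set as \<subseteq> {[c]}"
      then have "as = replicate ?n [c]"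
        by (auto simp: h_def intro!: replicate_eqI)
      then show "map (\<lambda>i. snd (h j) (map (\<lambda>a. a ! i) as)) [0..<1] \<in> {[c]}"
        using j td replicate_in_tuples[OF A(2)] by (simp add: h_def d_def[symmetric])
    qed
    moreover have "preserves (h j) ?r ?\<sigma>"
      unfolding preserves_def
    proof (intro allI impI)
      fix as assume "length as = fst (h j) \<and> set as \<subseteq> ?\<sigma>"
      then have as: "length as = ?n" "set as \<subseteq> ?\<sigma>" by (auto simp: h_def)
      define x where "x i = map (\<lambda>a. a ! i) as" for i
      have x: "x i \<in> tuples A ?n" if "i < ?r" for i
        unfolding x_def as(1)[symmetric]
        by (rule map_nth_in_tuples[OF as(2) _ that]) (auto simp: central_rel_def)
      let ?V = "(\<lambda>i. snd f (x i)) ` {..<?r}"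
      have ne: "(\<lambda>v. t v ! j) ` ?V \<noteq> A - {c}"
      proof
        assume img: "(\<lambda>v. t v ! j) ` ?V = A - {c}"
        have "t d ! j = c" using td j by simp
        \<comment> \<open>If \<open>f\<close> took the value \<open>d\<close> on some row, the
          output tuple would contain \<open>c\<close>.\<close>
        then have "d \<notin> ?V" using img by (metis DiffD2 imageI singletonI)
        then have sub: "?V \<subseteq> A - {d}" using x f snd_in_tuples by blast
        have "d \<in> A" unfolding d_def using f A snd_in_tuples replicate_in_tuples by metis
        \<comment> \<open>\<open>A - {d}\<close> and \<open>A - {c}\<close> have equal size, so
          \<open>?V\<close>, mapped onto the latter and contained in the former, fills
          \<open>A - {d}\<close>; the columns \<open>as\<close> then witness
          \<open>leaves_central\<close> for \<open>f\<close>.\<close>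
        then have "card (A - {d}) = card ((\<lambda>v. t v ! j) ` ?V)"
          using A img by simp
        also have "\<dots> \<le> card ?V" by (intro card_image_le) simp
        finally have V: "?V = A - {d}"
          using sub A by (intro card_seteq) auto
        then have "leaves_central A c f"
          unfolding leaves_central_def using as by (auto simp: x_def d_def)
        then show False using ts[OF leaves j] img V by simp
      qed
      have "map (\<lambda>i. snd (h j) (x i)) [0..<?r] = map (\<lambda>i. t (snd f (x i)) ! j) [0..<?r]"
        using x by (simp add: h_def)
      also have "\<dots> \<in> ?\<sigma>"
        unfolding mem_central_rel_iff[OF A]
        using ne tfj x j by (auto simp: tuples_def image_image atLeast0LessThan)
      finally show "map (\<lambda>i. snd (h j) (map (\<lambda>a. a ! i) as)) [0..<?r] \<in> ?\<sigma>"
        by (simp add: x_def)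
    qed
    ultimately show ?thesis by (simp add: Pol_def)
  qed
  then have "set (map h [0..<?p]) \<subseteq> nary (Pol A {(?r, ?\<sigma>), (1, {[c]})}) ?n"
    by (auto simp: nary_def h_def)
  moreover have "f = op_comp A ?n g (map h [0..<?p])"
  proof -
    have "snd f xs = snd g (map (\<lambda>k. snd k xs) (map h [0..<?p]))" if xs: "xs \<in> tuples A ?n" for xs
    proof -
      have "map (\<lambda>k. snd k xs) (map h [0..<?p]) = t (snd f xs)"
        using tf(1)[OF xs] xs by (intro nth_equalityI) (auto simp: h_def tuples_def)
      then show ?thesis using tf(2)[OF xs] by simp
    qed
    \<comment> \<open>Equality of operations also concerns arguments outside
      \<open>tuples A ?n\<close>, where both sides are \<open>undefined\<close>.\<close>
    moreover have "snd f \<in> extensional (tuples A ?n)"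
      using f by (auto simp: ops_def PiE_def)
    ultimately have "snd f = (\<lambda>xs\<in>tuples A ?n. snd g (map (\<lambda>k. snd k xs) (map h [0..<?p])))"
      by (intro extensionalityI) auto
    then show ?thesis by (simp add: op_comp_def prod_eq_iff)
  qed
  ultimately show ?thesis unfolding op_le_def by (intro exI[of _ "map h [0..<?p]"]) simp
qed

theorem theorem5p2:
  fixes A :: "'a set" and k :: nat and c :: 'a
  assumes "finite A" and "card A = k" and "k \<ge> 3" and "c \<in> A"
  shows "Pol A {(k - 1, central_rel A (k - 1) c), (1, {[c]})} \<in> finite_clones A"
proof (rule finite_clonesI)
  show "is_clone A (Pol A {(k - 1, central_rel A (k - 1) c), (1, {[c]})})"
    by (rule is_clone_Pol) (use assms in \<open>auto simp: central_rel_def tuples_def\<close>)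
next
  let ?data = "\<lambda>f. (snd f (replicate (fst f) c), snd f ` tuples A (fst f), leaves_central A c f)"
  have "?data ` ops A \<subseteq> A \<times> Pow A \<times> UNIV"
    using snd_in_tuples replicate_in_tuples[OF assms(4)] by blast
  then show "finite (?data ` ops A)"
    by (rule finite_subset) (use assms(1) in simp)
  fix f g assume "f \<in> ops A" "g \<in> ops A" "?data f = ?data g"
  then show "op_le A (Pol A {(k - 1, central_rel A (k - 1) c), (1, {[c]})}) f g"
    unfolding assms(2)[symmetric] by (intro op_le_Pol_central[OF assms(1,4)]) simp_all
qed

end
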